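(* For every positive integer $n$, the integer $C_n=\prod_{k=1}^n(k^3+1)=(1^3+1)(2^3+1)\cdots(n^3+1)$ is not the cube of an integer. *)

theory Defs
  imports Main
begin

end

theory Submission
  imports Defs Complex_Main "HOL-Number_Theory.Residues"
begin

text \<open>
  Write \<open>C\<^sub>n = N! Q\<close> with \<open>N = n + 1\<close> and \<open>Q = \<Prod>\<^bsub>k<n\<^esub> (k\<^sup>2 + k + 1)\<close>, and suppose that \<open>C\<^sub>n\<close> is a cube,
  so that all its prime exponents are multiples of 3. A prime \<open>p \<noteq> 3\<close> has at most two roots of
  \<open>x\<^sup>2 + x + 1\<close> modulo each \<open>p ^ j\<close>, hence a prime \<open>p > N\<close> has exponent at most 2 and does not occur
  at all. Primes \<open>p \<equiv> 2 (mod 3)\<close> do not divide \<open>Q\<close>.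

  If there is a prime \<open>p \<equiv> 2 (mod 3)\<close> in \<open>(N/3, N]\<close> with \<open>p\<^sup>2 > N\<close>, its exponent in \<open>C\<^sub>n\<close> is 1 or 2, a
  contradiction; the primes 5, 11, 29, 83, 239, 701, 2099 settle almost all \<open>N < 6297\<close> in this way.

  For larger \<open>N\<close>, compare \<open>C\<^sub>n\<close> with \<open>(N!) ^ 3 \<le> N ^ 3 C\<^sub>n\<close>. The primes \<open>p \<equiv> 2 (mod 3)\<close> occur in \<open>C\<^sub>n\<close>
  with only a third of their exponent in \<open>(N!) ^ 3\<close>, while a prime \<open>p \<equiv> 1 (mod 3)\<close> with
  \<open>p ^ 3 > N\<^sup>2\<close> exceeds its exponent there by at most 4, hence by at most 3 because both are
  multiples of 3. With Chebyshev's bound \<open>\<Prod>\<^bsub>p \<le> N\<^esub> p \<le> 4 ^ N\<close> the excess is too small to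
  compensate for the deficit, already at the primes 2, 3, 5, 11, 17, 23, 29, 41, 47.
\<close>

section \<open>Prime exponents of products and factorials\<close>

lemma multiplicity_eq_card_powers:
  fixes p x :: nat
  assumes "prime p" "x \<noteq> 0" "x < p ^ Suc J"
  shows "multiplicity p x = card {j \<in> {1..J}. p ^ j dvd x}"
proof -
  have "multiplicity p x \<le> J"
  proof (rule ccontr)
    assume "\<not> ?thesis"
    then have "p ^ Suc J dvd x"
      by (intro multiplicity_dvd') auto
    with assms show False
      by (auto dest: dvd_imp_le)
  qed
  then have "{j \<in> {1..J}. p ^ j dvd x} = {1..multiplicity p x}"
    using assms by (auto simp: power_dvd_iff_le_multiplicity dest: prime_gt_1_nat)
  then show ?thesis by simp
qed

text \<open>Double counting of the pairs \<open>(x, j)\<close> with \<open>p ^ j dvd f x\<close>;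
  the bound on \<open>f x\<close> excludes exponents above \<open>J\<close>.\<close>

lemma multiplicity_prod_eq_sum_card:
  fixes f :: "'a \<Rightarrow> nat"
  assumes p: "prime p" and fin: "finite A" and f: "\<And>x. x \<in> A \<Longrightarrow> f x \<noteq> 0 \<and> f x < p ^ Suc J"
  shows "multiplicity p (\<Prod>x\<in>A. f x) = (\<Sum>j = 1..J. card {x \<in> A. p ^ j dvd f x})"
proof -
  have f0: "f x \<noteq> 0" if "x \<in> A" for x using f that by blast
  have "multiplicity p (\<Prod>x\<in>A. f x) = (\<Sum>x\<in>A. multiplicity p (f x))"
    using p fin by (intro prime_elem_multiplicity_prod_distrib) (auto dest: f0)
  also have "\<dots> = (\<Sum>x\<in>A. card {j \<in> {1..J}. p ^ j dvd f x})"
    using p f by (intro sum.cong refl multiplicity_eq_card_powers) auto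
  also have "\<dots> = (\<Sum>x\<in>A. \<Sum>j = 1..J. if p ^ j dvd f x then 1 else 0)"
    by (intro sum.cong refl) (simp add: sum.If_cases Int_def)
  also have "\<dots> = (\<Sum>j = 1..J. \<Sum>x\<in>A. if p ^ j dvd f x then 1 else 0)"
    by (rule sum.swap)
  also have "\<dots> = (\<Sum>j = 1..J. card {x \<in> A. p ^ j dvd f x})"
    using fin by (intro sum.cong refl) (simp add: sum.If_cases Int_def)
  finally show ?thesis .
qed

lemma card_multiples:
  fixes q :: nat
  assumes "q > 0"
  shows "card {k \<in> {1..N}. q dvd k} = N div q"
proof -
  have "{k \<in> {1..N}. q dvd k} = (\<lambda>i. q * i) ` {1..N div q}"
    using assms by (auto simp: image_iff dvd_def less_eq_div_iff_mult_less_eq mult.commute)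
  moreover have "inj_on (\<lambda>i. q * i) {1..N div q}"
    using assms by (auto simp: inj_on_def)
  ultimately show ?thesis by (simp add: card_image)
qed

text \<open>Legendre's formula, cut off at any \<open>J\<close> beyond which the summands
  vanish.\<close>

lemma multiplicity_fact:
  assumes "prime p" "N < p ^ Suc J"
  shows "multiplicity p (fact N :: nat) = (\<Sum>j = 1..J. N div p ^ j)"
proof -
  have "multiplicity p (\<Prod>k\<in>{1..N}. k) = (\<Sum>j = 1..J. card {k \<in> {1..N}. p ^ j dvd k})"
    using assms by (intro multiplicity_prod_eq_sum_card) auto
  also have "\<dots> = (\<Sum>j = 1..J. N div p ^ j)"
    using assms by (intro sum.cong refl card_multiples) (auto simp: prime_gt_0_nat)
  finally show ?thesis by (simp add: fact_prod)
qed

text \<open>Dropping terms of Legendre's formula gives a lower bound. \<open>J\<close> is free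
  because later it is dictated by \<open>quad_prod\<close> or by numerical convenience, not by the
  size of \<open>N\<close>.\<close>

lemma multiplicity_fact_ge:
  assumes "prime p"
  shows "(\<Sum>j = 1..J. N div p ^ j) \<le> multiplicity p (fact N :: nat)"
proof -
  have "N < p ^ Suc (max J N)"
    using less_exp[of N] power_mono[of 2 p N] prime_ge_2_nat[OF assms]
      power_increasing[of N "Suc (max J N)" p] by linarith
  then have "multiplicity p (fact N :: nat) = (\<Sum>j = 1..max J N. N div p ^ j)"
    by (rule multiplicity_fact[OF assms])
  moreover have "(\<Sum>j = 1..J. N div p ^ j) \<le> (\<Sum>j = 1..max J N. N div p ^ j)"
    by (intro sum_mono2) auto
  ultimately show ?thesis by simp
qed

section \<open>Roots of x^2 + x + 1 modulo prime powers\<close>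

lemma card_residue_class_le:
  fixes q :: nat
  assumes "q > 0"
  shows "card {k \<in> {..<n}. k mod q = r} \<le> n div q + 1"
proof -
  have "inj_on (\<lambda>k. k div q) {k \<in> {..<n}. k mod q = r}"
    by (rule inj_onI) (metis (mono_tags, lifting) div_mod_decomp mem_Collect_eq)
  moreover have "(\<lambda>k. k div q) ` {k \<in> {..<n}. k mod q = r} \<subseteq> {..n div q}"
    by (auto intro: div_le_mono)
  ultimately have "card {k \<in> {..<n}. k mod q = r} \<le> card {..n div q}"
    by (intro card_inj_on_le) auto
  then show ?thesis by simp
qed

text \<open>Two roots \<open>i, k\<close> of \<open>x\<^sup>2 + x + 1\<close> satisfy \<open>(k - i) (k + i + 1) = 0\<close> modulo \<open>p ^ j\<close>, and
  \<open>p\<close> cannot divide both factors since the discriminant is \<open>-3\<close>.\<close>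

lemma card_roots_le:
  fixes p :: nat
  assumes p: "prime p" "p \<noteq> 3"
  shows "card {k \<in> {..<n}. p ^ j dvd k\<^sup>2 + k + 1} \<le> 2 * (n div p ^ j) + 2"
proof (cases "{k \<in> {..<n}. p ^ j dvd k\<^sup>2 + k + 1} = {}")
  case True
  then show ?thesis by (metis card.empty zero_le)
next
  case False
  then obtain i where i: "p ^ j dvd i\<^sup>2 + i + 1" by auto
  define q where "q = p ^ j"
  have q: "q > 0" using p by (simp add: q_def prime_gt_0_nat)
  \<comment> \<open>The other root \<open>- i - 1\<close>, since the two roots sum to -1; it is
    reduced in the integers because it is negative.\<close>
  define s where "s = nat ((- int i - 1) mod int q)"
  have ii: "int q dvd (int i)\<^sup>2 + int i + 1"
    using i unfolding q_def by (metis (mono_tags) int_dvd_int_iff of_nat_1 of_nat_add of_nat_power)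
  have "k mod q = i mod q \<or> k mod q = s" if k: "p ^ j dvd k\<^sup>2 + k + 1" for k
  proof -
    have kk: "int q dvd (int k)\<^sup>2 + int k + 1"
      using k unfolding q_def by (metis (mono_tags) int_dvd_int_iff of_nat_1 of_nat_add of_nat_power)
    have prod: "int q dvd (int k - int i) * (int k + int i + 1)"
      using dvd_diff[OF kk ii] by (simp add: algebra_simps power2_eq_square)
    have "int q dvd int k - int i \<or> int q dvd int k + int i + 1"
    proof (cases "int p dvd int k - int i")
      case False
      then have "coprime (int q) (int k - int i)"
        using p by (auto simp: q_def intro!: coprime_power_left_iff[THEN iffD2] prime_imp_coprime)
      with prod show ?thesis by (simp add: coprime_dvd_mult_right_iff)
    next
      case dvd1: True
      show ?thesis
      proof (cases "int p dvd int k + int i + 1")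
        case False
        then have "coprime (int q) (int k + int i + 1)"
          using p by (auto simp: q_def intro!: coprime_power_left_iff[THEN iffD2] prime_imp_coprime)
        with prod show ?thesis by (simp add: coprime_dvd_mult_left_iff)
      next
        case dvd2: True
        show ?thesis
        proof (cases "j = 0")
          case True then show ?thesis by (simp add: q_def)
        next
          case False
          then have "int p dvd int q" by (simp add: q_def)
          then have "int p dvd (int i)\<^sup>2 + int i + 1" using ii by (rule dvd_trans)
          moreover have "int p dvd 2 * int i + 1" using dvd_diff[OF dvd2 dvd1] by simp
          then have "int p dvd (2 * int i + 1) * (2 * int i + 1)" by simp
          ultimately have "int p dvd 4 * ((int i)\<^sup>2 + int i + 1) - (2 * int i + 1) * (2 * int i + 1)"
            by (rule dvd_diff[OF dvd_mult])
          also have "\<dots> = int 3" by (simp add: algebra_simps power2_eq_square)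
          finally have "p dvd 3" by (simp only: int_dvd_int_iff)
          moreover have "prime (3::nat)" by simp
          ultimately show ?thesis using p primes_dvd_imp_eq by blast
        qed
      qed
    qed
    then show ?thesis
    proof
      assume "int q dvd int k - int i"
      then have "int k mod int q = int i mod int q" by (simp add: mod_eq_dvd_iff)
      then show ?thesis by (metis of_nat_eq_iff zmod_int)
    next
      assume "int q dvd int k + int i + 1"
      then have "int k mod int q = (- int i - 1) mod int q"
        by (simp add: mod_eq_dvd_iff algebra_simps)
      then have "k mod q = s" unfolding s_def by (metis nat_int zmod_int)
      then show ?thesis ..
    qed
  qed
  then have "{k \<in> {..<n}. p ^ j dvd k\<^sup>2 + k + 1}
      \<subseteq> {k \<in> {..<n}. k mod q = i mod q} \<union> {k \<in> {..<n}. k mod q = s}" by auto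
  then have "card {k \<in> {..<n}. p ^ j dvd k\<^sup>2 + k + 1}
      \<le> card ({k \<in> {..<n}. k mod q = i mod q} \<union> {k \<in> {..<n}. k mod q = s})"
    by (intro card_mono) auto
  also have "\<dots> \<le> card {k \<in> {..<n}. k mod q = i mod q} + card {k \<in> {..<n}. k mod q = s}"
    by (rule card_Un_le)
  also have "\<dots> \<le> 2 * (n div q) + 2"
    using card_residue_class_le[OF q, of n "i mod q"] card_residue_class_le[OF q, of n s] by linarith
  finally show ?thesis by (simp add: q_def)
qed

lemma prime_mod_3_cases:
  assumes "prime (p :: nat)"
  shows "p = 3 \<or> p mod 3 = 1 \<or> p mod 3 = 2"
proof (cases "p mod 3 = 0")
  case True
  then have "3 dvd p" by auto
  moreover have "prime (3 :: nat)" by simp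
  ultimately show ?thesis using assms primes_dvd_imp_eq by blast
next
  case False
  then show ?thesis by linarith
qed

text \<open>If \<open>p = 3 m + 2\<close> divides \<open>k\<^sup>2 + k + 1\<close>, then \<open>k ^ 3 = 1\<close> modulo \<open>p\<close>, and Fermat's
  \<open>k ^ (3 m + 1) = 1\<close> gives \<open>k = 1\<close>, whence \<open>p\<close> divides 3.\<close>

lemma inert_not_dvd:
  fixes p k :: nat
  assumes p: "prime p" "p mod 3 = 2"
  shows "\<not> p dvd k\<^sup>2 + k + 1"
proof
  assume dvd: "p dvd k\<^sup>2 + k + 1"
  have "\<not> p dvd k"
  proof
    assume "p dvd k"
    then have "p dvd k\<^sup>2 + k" by (simp add: power2_eq_square)
    with dvd have "p dvd 1" using dvd_add_right_iff by blast
    with p show False by simp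
  qed
  then have fermat: "[k ^ (p - 1) = 1] (mod p)" using p fermat_theorem by blast
  have "[int k ^ 3 = 1] (mod int p)"
  proof -
    have "int p dvd int (k\<^sup>2 + k + 1)" using dvd by (simp only: int_dvd_int_iff)
    then have "int p dvd int (k\<^sup>2 + k + 1) * (int k - 1)" by simp
    also have "\<dots> = int k ^ 3 - 1" by (simp add: algebra_simps power2_eq_square power3_eq_cube)
    finally show ?thesis by (simp add: cong_iff_dvd_diff)
  qed
  then have cube: "[k ^ 3 = 1] (mod p)" using cong_int_iff[of "k^3" 1 p] by simp
  have exp: "p - 1 = 3 * (p div 3) + 1" using p div_mult_mod_eq[of p 3] by linarith
  have "[(k ^ 3) ^ (p div 3) * k = 1 ^ (p div 3) * k] (mod p)"
    by (intro cong_mult cong_pow cube cong_refl)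
  moreover have "(k ^ 3) ^ (p div 3) * k = k ^ (p - 1)"
    unfolding exp by (simp add: power_mult)
  ultimately have "[k = 1] (mod p)" using fermat by (metis cong_sym cong_trans mult_1 power_one)
  then have "[k\<^sup>2 + k + 1 = 1\<^sup>2 + 1 + 1] (mod p)" by (intro cong_add cong_pow cong_refl)
  then have "p dvd 3" using dvd by (auto simp: cong_dvd_iff numeral_3_eq_3)
  moreover have "prime (3::nat)" by simp
  ultimately have "p = 3" using p primes_dvd_imp_eq by blast
  with p show False by simp
qed

lemma square_add_mod:
  fixes k m :: nat
  shows "(k\<^sup>2 + k + 1) mod m = ((k mod m)\<^sup>2 + k mod m + 1) mod m"
proof -
  have "[k = k mod m] (mod m)" by simp
  then show ?thesis unfolding cong_def[symmetric] by (intro cong_add cong_pow cong_refl)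
qed

lemma not_9_dvd: "\<not> 9 dvd (k::nat)\<^sup>2 + k + 1"
proof -
  have "k mod 9 \<in> {0, 1, 2, 3, 4, 5, 6, 7, 8}" by auto
  then show ?thesis
    unfolding dvd_eq_mod_eq_0 square_add_mod[of k 9] by (auto simp: power2_eq_square)
qed

text \<open>The form \<open>3 dvd k + 2\<close> lets the shift by 2 carry the roots below
  \<open>n\<close> injectively to multiples of 3 up to \<open>n + 1\<close>, which are easily
  counted.\<close>

lemma dvd_3_iff: "3 dvd (k::nat)\<^sup>2 + k + 1 \<longleftrightarrow> 3 dvd k + 2"
proof -
  have "k mod 3 \<in> {0, 1, 2}" by auto
  moreover have "(k + 2) mod 3 = (k mod 3 + 2) mod 3" by presburger
  ultimately show ?thesis
    unfolding dvd_eq_mod_eq_0 square_add_mod[of k 3] by (auto simp: power2_eq_square) presburger+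
qed

section \<open>Chebyshev's bound for the product of the primes up to n\<close>

lemma prod_primes_dvd:
  fixes x :: nat
  assumes "finite B" "\<And>p. p \<in> B \<Longrightarrow> prime p \<and> p dvd x"
  shows "\<Prod>B dvd x"
  using assms
proof (induction B rule: finite_induct)
  case (insert p B)
  have "coprime p (\<Prod>B)"
    using insert by (intro prod_coprime_right) (auto intro: primes_coprime)
  then show ?case using insert by (auto intro: divides_mult)
qed simp

text \<open>Erdos's induction: an even \<open>n > 2\<close> reduces to \<open>n - 1\<close>; for
  \<open>n = 2 * m + 1\<close> the primes up to \<open>m + 1\<close> contribute at most
  \<open>4 ^ (m + 1)\<close>, and the larger ones all divide a binomial coefficient that is at most
  \<open>4 ^ m\<close>.\<close>

lemma prod_primes_le: "(\<Prod>p | prime p \<and> p \<le> n. p) \<le> (4::nat) ^ n"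
proof (induction n rule: less_induct)
  case (less n)
  consider "n \<le> 2" | "n > 2" "even n" | "n > 2" "odd n" by linarith
  then show ?case
  proof cases
    case 1
    have "{p. prime p \<and> p \<le> n} = (if n = 2 then {2} else {})"
      using 1 by (auto dest: prime_ge_2_nat)
    then show ?thesis by simp
  next
    case 2
    then have "\<not> prime n" using prime_odd_nat by auto
    then have "{p. prime p \<and> p \<le> n} = {p. prime p \<and> p \<le> n - 1}"
      using 2 by (auto simp: le_less) 
    then have "(\<Prod>p | prime p \<and> p \<le> n. p) \<le> 4 ^ (n - 1)" using less[of "n - 1"] 2 by simp
    also have "\<dots> \<le> 4 ^ n" by (intro power_increasing) auto
    finally show ?thesis .
  next
    case 3
    then obtain m where m: "n = 2 * m + 1" by (auto elim: oddE)
    define B where "B = {p. prime p \<and> m + 1 < p \<and> p \<le> n}"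
    have fin: "finite B" "finite {p. prime p \<and> p \<le> m + 1}" by (auto simp: B_def)
    have split: "{p. prime p \<and> p \<le> n} = {p. prime p \<and> p \<le> m + 1} \<union> B"
      using 3 by (auto simp: B_def m)
    have "\<Prod>B dvd (2 * m + 1) choose m"
    proof (rule prod_primes_dvd[OF fin(1)])
      fix p assume p: "p \<in> B"
      have "fact m * fact (m + 1) * ((2 * m + 1) choose m) = (fact (2 * m + 1) :: nat)"
        using binomial_fact_lemma[of m "2 * m + 1"] by simp
      moreover have "p dvd (fact (2 * m + 1) :: nat)"
        using p by (simp only: B_def m mem_Collect_eq prime_dvd_fact_iff)
      ultimately have "p dvd fact m * fact (m + 1) * ((2 * m + 1) choose m)" by simp
      then show "prime p \<and> p dvd (2 * m + 1) choose m"
        using p by (auto simp: B_def prime_dvd_mult_iff prime_dvd_fact_iff simp del: fact_Suc)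
    qed
    then have "\<Prod>B \<le> (2 * m + 1) choose m" by (intro dvd_imp_le) auto
    \<comment> \<open>The row sum \<open>2 ^ (2 * m + 1)\<close> contains two equal central
      coefficients; halving gives \<open>4 ^ m\<close>.\<close>
    moreover have "2 * ((2 * m + 1) choose m) = (\<Sum>k\<in>{m, m + 1}. (2 * m + 1) choose k)"
      using binomial_symmetric[of m "2 * m + 1"] by simp
    moreover have "\<dots> \<le> 2 ^ (2 * m + 1)"
      unfolding choose_row_sum[symmetric] by (intro sum_mono2) auto
    ultimately have B: "\<Prod>B \<le> 4 ^ m" by (simp add: power_mult del: binomial_Suc_Suc)
    have "(\<Prod>p | prime p \<and> p \<le> n. p) = (\<Prod>p | prime p \<and> p \<le> m + 1. p) * \<Prod>B"
      unfolding split using fin by (intro prod.union_disjoint) (auto simp: B_def)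
    also have "\<dots> \<le> 4 ^ (m + 1) * 4 ^ m" using 3 B less[of "m + 1"] m by (intro mult_mono) auto
    also have "\<dots> = 4 ^ n" by (simp add: m power_add mult_2)
    finally show ?thesis .
  qed
qed


section \<open>The factorisation of C_n and its prime exponents\<close>

definition quad_prod :: "nat \<Rightarrow> nat"
  where "quad_prod n = (\<Prod>k<n. k\<^sup>2 + k + 1)"

lemma quad_prod_pos: "quad_prod n > 0"
  by (simp add: quad_prod_def)

text \<open>From \<open>k ^ 3 + 1 = (k + 1) * (k\<^sup>2 - k + 1)\<close>; replacing
  \<open>k\<close> by \<open>k + 1\<close> in the second factor gives the terms of
  \<open>quad_prod\<close>, free of subtraction.\<close>

lemma prod_cubes_eq: "(\<Prod>k = 1..n. k ^ 3 + 1) = fact (n + 1) * quad_prod n"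
  by (induction n) (simp_all add: quad_prod_def algebra_simps power2_eq_square power3_eq_cube)

lemma quad_term_le: "k < n \<Longrightarrow> k\<^sup>2 + k + 1 \<le> n\<^sup>2" for k n :: nat
proof -
  assume "k < n"
  then have "(k + 1)\<^sup>2 \<le> n\<^sup>2" by (intro power_mono) auto
  then show ?thesis by (simp add: power2_eq_square)
qed

text \<open>At each level \<open>j \<le> J\<close> there are at most two root classes, each with at
  most \<open>n div p ^ j + 1\<close> members. The quotients are absorbed by the Legendre sum of the
  factorial, and the summands 1 leave \<open>2 * J\<close>.\<close>

lemma multiplicity_quad_prod_le:
  assumes p: "prime p" "p \<noteq> 3" and J: "n\<^sup>2 < p ^ Suc J"
  shows "multiplicity p (quad_prod n) \<le> 2 * multiplicity p (fact (n + 1) :: nat) + 2 * J"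
proof -
  have "multiplicity p (quad_prod n)
      = (\<Sum>j = 1..J. card {k \<in> {..<n}. p ^ j dvd k\<^sup>2 + k + 1})"
    unfolding quad_prod_def using p(1)
  proof (rule multiplicity_prod_eq_sum_card)
    show "k\<^sup>2 + k + 1 \<noteq> 0 \<and> k\<^sup>2 + k + 1 < p ^ Suc J" if "k \<in> {..<n}" for k
      using quad_term_le[of k n] that J by auto
  qed simp
  also have "\<dots> \<le> (\<Sum>j = 1..J. 2 * ((n + 1) div p ^ j) + 2)"
  proof (rule sum_mono)
    fix j
    show "card {k \<in> {..<n}. p ^ j dvd k\<^sup>2 + k + 1} \<le> 2 * ((n + 1) div p ^ j) + 2"
      using card_roots_le[OF p, of n j] div_le_mono[of n "n + 1" "p ^ j"] by linarith
  qed
  also have "\<dots> = 2 * (\<Sum>j = 1..J. (n + 1) div p ^ j) + 2 * J"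
    by (simp only: sum.distrib sum_distrib_left) simp
  also have "\<dots> \<le> 2 * multiplicity p (fact (n + 1) :: nat) + 2 * J"
    using multiplicity_fact_ge[OF p(1), of "n + 1" J] by linarith
  finally show ?thesis .
qed

text \<open>No term is divisible by 9, so only the level \<open>j = 1\<close> counts.\<close>

lemma multiplicity_3_quad_prod_le: "multiplicity 3 (quad_prod n) \<le> (n + 1) div 3"
proof -
  define f where "f j = card {k \<in> {..<n}. 3 ^ j dvd k\<^sup>2 + k + 1}" for j :: nat
  have "multiplicity 3 (quad_prod n) = (\<Sum>j = 1..n\<^sup>2. f j)"
    unfolding quad_prod_def f_def
  proof (rule multiplicity_prod_eq_sum_card)
    fix k assume "k \<in> {..<n}"
    then have "k\<^sup>2 + k + 1 \<le> n\<^sup>2" by (simp only: lessThan_iff quad_term_le)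
    also have "\<dots> < 2 ^ (n\<^sup>2)" by (rule less_exp)
    also have "\<dots> \<le> 3 ^ (n\<^sup>2)" by (intro power_mono) auto
    also have "\<dots> \<le> 3 ^ Suc (n\<^sup>2)" by simp
    finally show "k\<^sup>2 + k + 1 \<noteq> 0 \<and> k\<^sup>2 + k + 1 < 3 ^ Suc (n\<^sup>2)" by simp
  qed auto
  \<comment> \<open>The extra summand allows \<open>f 1\<close> to be split off even when
    \<open>n = 0\<close>.\<close>
  also have "\<dots> \<le> (\<Sum>j = 1..Suc (n\<^sup>2). f j)" by simp
  also have "\<dots> = f 1 + (\<Sum>j = 2..Suc (n\<^sup>2). f j)"
    by (subst sum.atLeast_Suc_atMost) (auto simp: numeral_2_eq_2)
  also have "(\<Sum>j = 2..Suc (n\<^sup>2). f j) = 0"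
  proof (rule sum.neutral, rule ballI)
    fix j assume "j \<in> {2..Suc (n\<^sup>2)}"
    then have "(9::nat) dvd 3 ^ j" using le_imp_power_dvd[of 2 j "3::nat"] by simp
    then have "{k \<in> {..<n}. 3 ^ j dvd k\<^sup>2 + k + 1} = {}" using not_9_dvd dvd_trans by blast
    then show "f j = 0" unfolding f_def by (metis card.empty)
  qed
  also have "f 1 \<le> card {k \<in> {1..n + 1}. 3 dvd k}"
    unfolding f_def by (rule card_inj_on_le[of "\<lambda>k. k + 2"]) (auto simp: inj_on_def dvd_3_iff[simplified])
  also have "\<dots> = (n + 1) div 3" by (rule card_multiples) simp
  finally show ?thesis by simp
qed

lemma multiplicity_inert_quad_prod:
  assumes "prime p" "p mod 3 = 2"
  shows "multiplicity p (quad_prod n) = 0"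
  unfolding quad_prod_def
proof (rule not_dvd_imp_multiplicity_0)
  show "\<not> p dvd (\<Prod>k<n. k\<^sup>2 + k + 1)"
    using assms inert_not_dvd[OF assms] by (subst prime_dvd_prod_iff) auto
qed

lemma multiplicity_fact_mult_quad_prod:
  assumes "prime p"
  shows "multiplicity p (fact (n + 1) * quad_prod n)
    = multiplicity p (fact (n + 1) :: nat) + multiplicity p (quad_prod n)"
  using assms quad_prod_pos[of n] by (intro prime_elem_multiplicity_mult_distrib) auto

lemma three_dvd_multiplicity_cube:
  fixes c p :: nat
  assumes "prime p" "c > 0"
  shows "3 dvd multiplicity p (c ^ 3)"
  using assms by (subst prime_elem_multiplicity_power_distrib) auto

text \<open>Here \<open>J = 2\<close> suffices and gives an excess of 4, which divisibility by 3
  lowers to 3. The saving is decisive: an excess of 4 would raise the Chebyshev term from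
  \<open>6 * N * ln 2\<close> to \<open>8 * N * ln 2\<close>, beyond the roughly 6.63 N ln 2
  collected in \<open>not_cube_large\<close>.\<close>

lemma multiplicity_cube_le:
  assumes cube: "fact (n + 1) * quad_prod n = c ^ 3"
    and p: "prime p" "p \<noteq> 3" "n\<^sup>2 < p ^ 3"
  shows "multiplicity p (c ^ 3) \<le> 3 * multiplicity p (fact (n + 1) :: nat) + 3"
proof -
  have "c > 0" using cube quad_prod_pos[of n] by (cases "c = 0") auto
  then have "3 dvd multiplicity p (c ^ 3)" by (rule three_dvd_multiplicity_cube[OF p(1)])
  moreover have "n\<^sup>2 < p ^ Suc 2" using p(3) by (simp add: numeral_3_eq_3)
  then have "multiplicity p (c ^ 3) \<le> 3 * multiplicity p (fact (n + 1) :: nat) + 4"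
    using multiplicity_quad_prod_le[OF p(1,2), of n 2] multiplicity_fact_mult_quad_prod[OF p(1), of n]
    unfolding cube by linarith
  ultimately show ?thesis by presburger
qed

text \<open>A prime \<open>p > n + 1\<close> misses the factorial, and
  \<open>n\<^sup>2 < p\<^sup>2\<close> allows \<open>J = 1\<close>, so its exponent is at most 2 and
  cannot be a positive multiple of 3.\<close>

lemma prime_dvd_cube_le:
  assumes cube: "fact (n + 1) * quad_prod n = c ^ 3"
    and p: "prime p" "p dvd c ^ 3"
  shows "p \<le> n + 1"
proof (rule ccontr)
  assume "\<not> p \<le> n + 1"
  then have less: "n + 1 < p" by simp
  have c: "c > 0" using cube quad_prod_pos[of n] by (cases "c = 0") auto
  have fact0: "multiplicity p (fact (n + 1) :: nat) = 0"
    using p less by (intro not_dvd_imp_multiplicity_0) (simp only: prime_dvd_fact_iff not_le)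
  have "multiplicity p (quad_prod n) \<le> 2"
  proof (cases "p = 3")
    case True
    then show ?thesis using multiplicity_3_quad_prod_le[of n] less by simp
  next
    case False
    have "n\<^sup>2 < p ^ Suc 1" using less power_strict_mono[of n p 2] by (simp add: power2_eq_square)
    then show ?thesis using multiplicity_quad_prod_le[OF p(1) False, of n 1] fact0 by linarith
  qed
  then have "multiplicity p (c ^ 3) \<le> 2"
    using multiplicity_fact_mult_quad_prod[OF p(1), of n] fact0 unfolding cube by linarith
  moreover have "3 dvd multiplicity p (c ^ 3)" by (rule three_dvd_multiplicity_cube[OF p(1) c])
  moreover have "multiplicity p (c ^ 3) > 0" using p c by (simp add: prime_multiplicity_gt_zero_iff)
  ultimately show False by (auto dest: dvd_imp_le)
qed

text \<open>The exponent of \<open>p\<close> is exactly \<open>(n + 1) div p\<close>, because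
  \<open>p\<close> misses \<open>quad_prod n\<close> and \<open>n + 1 < p\<^sup>2\<close> leaves a
  single Legendre term; this quotient is 1 or 2.\<close>

lemma not_cube_of_inert_prime:
  assumes p: "prime p" "p mod 3 = 2" and n: "p \<le> n + 1" "n + 1 < 3 * p" "n + 1 < p\<^sup>2"
  shows "fact (n + 1) * quad_prod n \<noteq> c ^ 3"
proof
  assume cube: "fact (n + 1) * quad_prod n = c ^ 3"
  have c: "c > 0" using cube quad_prod_pos[of n] by (cases "c = 0") auto
  have "multiplicity p (c ^ 3) = (n + 1) div p"
    using multiplicity_fact_mult_quad_prod[OF p(1), of n] multiplicity_inert_quad_prod[OF p, of n]
      multiplicity_fact[OF p(1), of "n + 1" 1] n(3)
    unfolding cube by (simp add: power2_eq_square del: fact_Suc)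
  moreover have "(n + 1) div p < 3" using n(2) by (simp add: less_mult_imp_div_less)
  moreover have "(n + 1) div p > 0" using n(1) p by (simp add: div_greater_zero_iff prime_gt_0_nat)
  ultimately show False using three_dvd_multiplicity_cube[OF p(1) c] by (auto dest: dvd_imp_le)
qed

section \<open>Logarithmic comparison of C_n with the cube of the factorial\<close>

lemma ln_eq_sum_multiplicity:
  fixes x :: nat
  assumes "x > 0" "finite P" "\<And>p. p \<in> P \<Longrightarrow> prime p" "prime_factors x \<subseteq> P"
  shows "ln (real x) = (\<Sum>p\<in>P. real (multiplicity p x) * ln (real p))"
proof -
  have pos: "p > 0" if "p \<in> prime_factors x" for p
    using that by (auto dest: in_prime_factors_imp_prime prime_gt_0_nat)
  have "ln (real x) = ln (real (\<Prod>p\<in>prime_factors x. p ^ multiplicity p x))"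
    by (rule arg_cong[OF prime_factorization_nat[OF assms(1)], where f = "\<lambda>x. ln (real x)"])
  also have "\<dots> = (\<Sum>p\<in>prime_factors x. real (multiplicity p x) * ln (real p))"
    using pos by (simp add: ln_prod ln_realpow)
  also have "\<dots> = (\<Sum>p\<in>P. real (multiplicity p x) * ln (real p))"
  proof (intro sum.mono_neutral_left ballI)
    fix p assume "p \<in> P - prime_factors x"
    with assms have "multiplicity p x = 0"
      by (intro not_dvd_imp_multiplicity_0) (auto simp: prime_factors_dvd)
    then show "real (multiplicity p x) * ln (real p) = 0" by simp
  qed (use assms in auto)
  finally show ?thesis .
qed

lemma sum_ln_primes_le: "(\<Sum>p | prime p \<and> p \<le> n. ln (real p)) \<le> 2 * real n * ln 2"
proof -
  have pos: "p > 0" if "p \<in> {p. prime p \<and> p \<le> n}" for p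
    using that by (auto dest: prime_gt_0_nat)
  have "(\<Sum>p | prime p \<and> p \<le> n. ln (real p)) = ln (real (\<Prod>p | prime p \<and> p \<le> n. p))"
    unfolding of_nat_prod by (rule ln_prod[symmetric]) (use pos in fastforce)+
  also have "\<dots> \<le> ln (real (4 ^ n))"
    using prod_primes_le[of n] pos
    by (subst ln_le_cancel_iff) (auto intro!: prod_pos simp del: of_nat_prod of_nat_power)
  also have "\<dots> = 2 * real n * ln 2"
    using ln_realpow[of "2::real" 2] by (simp add: ln_realpow)
  finally show ?thesis .
qed

lemma ln_fact_cube_le:
  "3 * ln (real (fact (n + 1))) \<le> 3 * ln (real (n + 1)) + ln (real (fact (n + 1) * quad_prod n))"
proof -
  have "(\<Prod>k = 1..n. k) ^ 3 \<le> (\<Prod>k = 1..n. k ^ 3 + 1)"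
    unfolding prod_power_distrib by (intro prod_mono) auto
  then have "fact n ^ 3 \<le> fact (n + 1) * quad_prod n"
    by (simp only: prod_cubes_eq fact_prod of_nat_id)
  then have "(n + 1) ^ 3 * fact n ^ 3 \<le> (n + 1) ^ 3 * (fact (n + 1) * quad_prod n)"
    by (rule mult_le_mono2)
  also have "(n + 1) ^ 3 * fact n ^ 3 = (fact (n + 1) :: nat) ^ 3"
    by (simp only: Suc_eq_plus1[symmetric] fact_Suc of_nat_id power_mult_distrib)
  finally have "fact (n + 1) ^ 3 \<le> (n + 1) ^ 3 * (fact (n + 1) * quad_prod n)" .
  then have "real (fact (n + 1) ^ 3) \<le> real ((n + 1) ^ 3 * (fact (n + 1) * quad_prod n))"
    by (simp only: of_nat_le_iff)
  then have "ln (real (fact (n + 1)) ^ 3)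
      \<le> ln (real (n + 1) ^ 3 * real (fact (n + 1) * quad_prod n))"
    using quad_prod_pos[of n] by (subst ln_le_cancel_iff) (auto simp del: fact_Suc)
  then show ?thesis
    using quad_prod_pos[of n] by (subst (asm) ln_mult) (auto simp: ln_realpow simp del: fact_Suc of_nat_mult)
qed

text \<open>Primes that are 1 modulo 3 split in the Eisenstein integers, those that are 2 stay
  inert. Collected here are the split primes too small for \<open>multiplicity_cube_le\<close> to be
  guaranteed to apply.\<close>

definition small_split :: "nat \<Rightarrow> nat set"
  where "small_split N = {p. prime p \<and> p mod 3 = 1 \<and> p ^ 3 \<le> N\<^sup>2}"

lemma finite_small_split: "finite (small_split N)"
proof (rule finite_subset)
  show "small_split N \<subseteq> {..N\<^sup>2}"
  proof
    fix p assume "p \<in> small_split N"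
    then have "p ^ 3 \<le> N\<^sup>2" "p \<le> p ^ 3"
      using self_le_power[of p 3] prime_ge_1_nat[of p] by (auto simp: small_split_def)
    then show "p \<in> {..N\<^sup>2}" by simp
  qed
qed simp

text \<open>The members are 1 modulo 6 and exceed 1, so \<open>p div 6\<close> maps them injectively
  into 1 to \<open>M div 6\<close> for the largest member \<open>M\<close>. Cubing keeps the bound
  within the natural numbers.\<close>

lemma card_small_split: "(6 * card (small_split N)) ^ 3 \<le> N\<^sup>2"
proof (cases "small_split N = {}")
  case False
  define M where "M = Max (small_split N)"
  have M: "M \<in> small_split N" using False finite_small_split unfolding M_def by simp
  have mod6: "p mod 6 = 1" if "p \<in> small_split N" for p
  proof -
    have "p \<noteq> 2" using that by (auto simp: small_split_def)
    then have "odd p" using that prime_odd_nat[of p] prime_ge_2_nat[of p] by (auto simp: small_split_def)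
    moreover have "p mod 3 = 1" using that by (simp add: small_split_def)
    ultimately show ?thesis by presburger
  qed
  have "inj_on (\<lambda>p. p div 6) (small_split N)"
    by (rule inj_onI) (metis mod6 div_mult_mod_eq)
  moreover have "(\<lambda>p. p div 6) ` small_split N \<subseteq> {1..M div 6}"
  proof
    fix i assume "i \<in> (\<lambda>p. p div 6) ` small_split N"
    then obtain p where p: "p \<in> small_split N" "i = p div 6" by auto
    have "p \<le> M" unfolding M_def using p finite_small_split by simp
    moreover have "p \<noteq> 1" using p by (auto simp: small_split_def)
    then have "i \<noteq> 0" using mod6[OF p(1)] p(2) by (metis div_mult_mod_eq mult_0 add_0)
    ultimately show "i \<in> {1..M div 6}" using p by (auto intro: div_le_mono)
  qed
  ultimately have "card (small_split N) \<le> M div 6"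
    using card_inj_on_le[of "\<lambda>p. p div 6" "small_split N" "{1..M div 6}"] by simp
  then have "6 * card (small_split N) \<le> M" by linarith
  then have "(6 * card (small_split N)) ^ 3 \<le> M ^ 3" by (intro power_mono) auto
  also have "\<dots> \<le> N\<^sup>2" using M by (simp add: small_split_def)
  finally show ?thesis .
qed simp

text \<open>Outside \<open>small_split\<close> the excess is at most 3. Inside it is at most
  \<open>2 * J\<close>, where \<open>p ^ J \<le> n\<^sup>2\<close>, which costs at most
  \<open>4 * ln n\<close>; the term \<open>3 * ln p\<close> is granted in both cases so that it can
  be summed uniformly.\<close>

lemma multiplicity_cube_ln_le:
  assumes cube: "fact (n + 1) * quad_prod n = c ^ 3" and p: "prime p" "p mod 3 = 1"
    and n: "n > 0"
  shows "(real (multiplicity p (c ^ 3)) - 3 * real (multiplicity p (fact (n + 1) :: nat))) * ln (real p)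
    \<le> 3 * ln (real p) + (if p \<in> small_split (n + 1) then 4 * ln (real (n + 1)) else 0)"
    (is "(?v - 3 * ?w) * _ \<le> _")
proof -
  have p3: "p \<noteq> 3" using p by auto
  have lnp: "ln (real p) \<ge> 0" using p prime_ge_1_nat[of p] by simp
  show ?thesis
  proof (cases "p \<in> small_split (n + 1)")
    case False
    then have "(n + 1)\<^sup>2 < p ^ 3" using p by (simp add: small_split_def)
    then have "n\<^sup>2 < p ^ 3" using power_mono[of n "n + 1" 2] by linarith
    then have "?v - 3 * ?w \<le> 3"
      using multiplicity_cube_le[OF cube p(1) p3] by linarith
    then show ?thesis using False lnp by (simp add: mult_right_mono)
  next
    case True
    obtain J where J: "p ^ J \<le> n\<^sup>2" "n\<^sup>2 < p ^ (J + 1)"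
      using ex_power_ivl1[of p "n\<^sup>2"] p n prime_ge_2_nat[of p] by (auto simp: Suc_le_eq)
    have "multiplicity p (c ^ 3) \<le> 3 * multiplicity p (fact (n + 1) :: nat) + 2 * J"
      using multiplicity_quad_prod_le[OF p(1) p3, of n J] J(2)
        multiplicity_fact_mult_quad_prod[OF p(1), of n]
      unfolding cube by (simp del: fact_Suc)
    then have "?v - 3 * ?w \<le> 2 * real J" by linarith
    then have "(?v - 3 * ?w) * ln (real p) \<le> 2 * (real J * ln (real p))"
      using lnp by (simp add: mult_right_mono flip: mult.assoc)
    also have "real J * ln (real p) = ln (real (p ^ J))"
      using p by (simp add: ln_realpow prime_gt_0_nat)
    also have "\<dots> \<le> ln (real (n\<^sup>2))"
      using J(1) p by (subst ln_le_cancel_iff) (auto simp: prime_gt_0_nat n simp del: of_nat_power)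
    also have "\<dots> = 2 * ln (real n)" using n by (simp add: ln_realpow)
    also have "\<dots> \<le> 2 * ln (real (n + 1))" using n by simp
    finally show ?thesis using True lnp by simp
  qed
qed

text \<open>Summing exponent differences times \<open>ln p\<close> over all primes up to
  \<open>n + 1\<close> gives 3 ln (n+1)! - ln C_n, at most \<open>3 * ln (n + 1)\<close>. Inert
  primes enter with twice their factorial exponent, those outside \<open>S\<close> being dropped;
  the loss at split primes moves to the right side.\<close>

lemma weighted_inert_primes_le:
  fixes S :: "nat set"
  assumes cube: "fact (n + 1) * quad_prod n = c ^ 3"
    and S: "finite S" "\<And>p. p \<in> S \<Longrightarrow> prime p \<and> p mod 3 = 2 \<and> p \<le> n + 1" and n: "n \<ge> 2"
  shows "(\<Sum>p\<in>S. 2 * real (multiplicity p (fact (n + 1) :: nat)) * ln (real p))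
      + (2 * real (multiplicity 3 (fact (n + 1) :: nat)) - real ((n + 1) div 3)) * ln 3
    \<le> 3 * ln (real (n + 1)) + 6 * real (n + 1) * ln 2
      + 4 * real (card (small_split (n + 1))) * ln (real (n + 1))"
proof -
  define N where "N = n + 1"
  define P where "P = {p. prime p \<and> p \<le> N}"
  define v where "v p = real (multiplicity p (c ^ 3))" for p
  define w where "w p = real (multiplicity p (fact N :: nat))" for p
  \<comment> \<open>\<open>g\<close> and \<open>h\<close> are the gains at \<open>S\<close> and at
    3, \<open>s\<close> the extra loss at small split primes. The loss \<open>3 * ln p\<close> is
    charged to every prime, since \<open>sum_ln_primes_le\<close> does not separate residue
    classes.\<close>
  define g where "g p = (if p \<in> S then 2 * w p * ln (real p) else 0)" for p
  define h where "h p = (if p = 3 then (2 * w p - real (N div 3)) * ln (real p) else 0)" for p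
  define s where "s p = (if p \<in> small_split N then 4 * ln (real N) else 0)" for p
  have c: "c > 0" using cube quad_prod_pos[of n] by (cases "c = 0") auto
  have finP: "finite P" by (auto simp: P_def)
  have SP: "S \<subseteq> P" using S by (auto simp: P_def N_def)
  have "3 \<in> P" using n by (simp add: P_def N_def)
  have pointwise: "g p + h p - 3 * ln (real p) - s p \<le> (3 * w p - v p) * ln (real p)" if "p \<in> P" for p
  proof -
    have p: "prime p" using that by (simp add: P_def)
    have lnp: "ln (real p) \<ge> 0" using p prime_ge_1_nat[of p] by simp
    have s: "s p \<ge> 0" by (simp add: s_def N_def)
    have v: "v p = w p + real (multiplicity p (quad_prod n))"
      using multiplicity_fact_mult_quad_prod[OF p, of n] unfolding cube by (simp add: v_def w_def N_def del: fact_Suc)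
    consider "p = 3" | "p mod 3 = 1" | "p mod 3 = 2" using prime_mod_3_cases[OF p] by blast
    then show ?thesis
    proof cases
      case 1
      then have "g p = 0" using S(2)[of 3] by (auto simp: g_def)
      moreover have "(2 * w p - real (N div 3)) * ln (real p) \<le> (3 * w p - v p) * ln (real p)"
        using multiplicity_3_quad_prod_le[of n] lnp v unfolding 1 N_def
        by (intro mult_right_mono) linarith+
      moreover have "h p = (2 * w p - real (N div 3)) * ln (real p)" using 1 by (simp add: h_def)
      ultimately show ?thesis using s lnp by linarith
    next
      case 2
      then have "g p = 0" "h p = 0" using S(2) by (auto simp: g_def h_def)
      then show ?thesis using multiplicity_cube_ln_le[OF cube p 2] n
        unfolding v_def w_def s_def N_def left_diff_distrib by linarith
    next
      case 3
      then have "v p = w p" using multiplicity_inert_quad_prod[OF p 3, of n] v by simp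
      moreover have "h p = 0" using 3 by (auto simp: h_def)
      moreover have "g p \<le> 2 * w p * ln (real p)" using lnp by (simp add: g_def w_def)
      ultimately show ?thesis using s lnp by simp
    qed
  qed
  have "(\<Sum>p\<in>P. g p) = (\<Sum>p\<in>S. 2 * w p * ln (real p))"
    unfolding g_def using SP finP by (simp add: sum.If_cases Int_absorb1)
  moreover have "(\<Sum>p\<in>P. h p) = (2 * w 3 - real (N div 3)) * ln 3"
    unfolding h_def using finP \<open>3 \<in> P\<close> by simp
  moreover have "(\<Sum>p\<in>P. s p) \<le> 4 * real (card (small_split N)) * ln (real N)"
  proof -
    have "(\<Sum>p\<in>P. s p) = real (card (P \<inter> small_split N)) * (4 * ln (real N))"
      unfolding s_def using finP by (simp add: sum.If_cases)
    also have "\<dots> \<le> real (card (small_split N)) * (4 * ln (real N))"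
      using finite_small_split[of N] by (intro mult_right_mono) (auto intro: card_mono simp: N_def)
    finally show ?thesis by simp
  qed
  moreover have "(\<Sum>p\<in>P. ln (real p)) \<le> 2 * real N * ln 2"
    unfolding P_def by (rule sum_ln_primes_le)
  moreover have "(\<Sum>p\<in>P. g p + h p - 3 * ln (real p) - s p) \<le> (\<Sum>p\<in>P. (3 * w p - v p) * ln (real p))"
    by (intro sum_mono pointwise)
  moreover have "(\<Sum>p\<in>P. (3 * w p - v p) * ln (real p)) \<le> 3 * ln (real N)"
  proof -
    \<comment> \<open>Both logarithms expand over the same \<open>P\<close>, because
      \<open>prime_dvd_cube_le\<close> keeps the primes of \<open>c ^ 3\<close> below
      \<open>N + 1\<close>.\<close>
    have "ln (real (c ^ 3)) = (\<Sum>p\<in>P. v p * ln (real p))"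
      unfolding v_def using c finP prime_dvd_cube_le[OF cube]
      by (intro ln_eq_sum_multiplicity) (auto simp: P_def N_def prime_factors_dvd)
    moreover have "ln (real (fact N)) = (\<Sum>p\<in>P. w p * ln (real p))"
      unfolding w_def using finP
      by (intro ln_eq_sum_multiplicity) (auto simp: P_def prime_factors_dvd prime_dvd_fact_iff)
    moreover have "(\<Sum>p\<in>P. (3 * w p - v p) * ln (real p))
        = 3 * (\<Sum>p\<in>P. w p * ln (real p)) - (\<Sum>p\<in>P. v p * ln (real p))"
      by (simp add: left_diff_distrib sum_subtractf sum_distrib_left mult.assoc)
    ultimately show ?thesis
      using ln_fact_cube_le[of n] unfolding cube unfolding N_def[symmetric] by linarith
  qed
  ultimately show ?thesis
    unfolding N_def[symmetric] w_def[symmetric]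
    by (simp add: sum.distrib sum_subtractf flip: sum_distrib_left)
qed


section \<open>Numerical bounds and the case of large n\<close>

lemma multiplicity_fact_ge_real:
  assumes "prime p"
  shows "(\<Sum>j = 1..J. real N / real p ^ j) - real J \<le> real (multiplicity p (fact N :: nat))"
proof -
  have "(\<Sum>j = 1..J. real N / real p ^ j) - real J = (\<Sum>j = 1..J. real N / real p ^ j - 1)"
    by (simp add: sum_subtractf)
  also have "\<dots> \<le> (\<Sum>j = 1..J. real (N div p ^ j))"
  proof (rule sum_mono)
    fix j
    show "real N / real p ^ j - 1 \<le> real (N div p ^ j)"
      using floor_divide_of_nat_eq[of N "p ^ j", where ?'a = real] by simp linarith
  qed
  also have "\<dots> \<le> real (multiplicity p (fact N :: nat))"
    using multiplicity_fact_ge[OF assms, of N J] by (simp flip: of_nat_sum)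
  finally show ?thesis .
qed

text \<open>Certifies \<open>a / b\<close> as a rational lower bound for log_2 p, so that the
  estimates become multiples of \<open>ln 2\<close>, which finally cancels.\<close>

lemma ln_ge_of_power_le:
  fixes p :: nat
  assumes "p > 0" "2 ^ a \<le> p ^ b" "b > 0"
  shows "real a / real b * ln 2 \<le> ln (real p)"
proof -
  have "real (2 ^ a) \<le> real (p ^ b)" using assms(2) by (simp only: of_nat_le_iff)
  then have "ln (2 ^ a :: real) \<le> ln (real p ^ b)"
    using assms(1) by (subst ln_le_cancel_iff) auto
  then have "real a * ln 2 \<le> real b * ln (real p)"
    using assms(1) by (simp add: ln_realpow)
  then show ?thesis using assms(3) by (simp add: field_simps)
qed

text \<open>\<open>ln x \<le> x - 1\<close> is sharp only near 1, so it is applied to slight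
  overestimates of the 16th roots of 1/2 and 2.\<close>

lemma ln2_bounds: "2 / 3 \<le> ln (2 :: real)" "1.4 * ln (2 :: real) \<le> 1"
proof -
  have "- ln 2 = ln (1 / 2 :: real)" by (simp add: ln_div)
  also have "\<dots> \<le> ln ((23 / 24) ^ 16)" by (subst ln_le_cancel_iff) (simp_all add: power_divide)
  also have "\<dots> \<le> 16 * (23 / 24 - 1)" using ln_le_minus_one[of "23 / 24"] by (simp add: ln_realpow)
  finally show "2 / 3 \<le> ln (2 :: real)" by simp
  have "ln 2 \<le> ln ((2089 / 2000 :: real) ^ 16)" by (subst ln_le_cancel_iff) (simp_all add: power_divide)
  also have "\<dots> \<le> 16 * (2089 / 2000 - 1)"
    using ln_le_minus_one[of "2089 / 2000"] by (simp add: ln_realpow)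
  finally show "1.4 * ln (2 :: real) \<le> 1" by simp
qed

text \<open>The tangent of \<open>ln\<close> at 32, a point near the range where the estimate is tight.\<close>

lemma ln_cube_le:
  fixes u :: real
  assumes "u > 0"
  shows "ln (u ^ 3) \<le> 3 * (18 / 5 + 469 / 10000 * u) * ln 2"
proof -
  have "ln u - ln 32 \<le> u / 32 - 1" using assms ln_le_minus_one[of "u / 32"] by (simp add: ln_div)
  moreover have "ln (32 :: real) = 5 * ln 2" using ln_realpow[of "2::real" 5] by simp
  moreover have "u / 32 \<le> 469 / 10000 * u * ln 2"
    using assms ln2_bounds(1) mult_left_mono[of "2/3" "ln 2" "469 / 10000 * u"] by simp
  ultimately have "ln u \<le> (18 / 5 + 469 / 10000 * u) * ln 2"
    using ln2_bounds(2) unfolding distrib_right by linarith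
  then have "3 * ln u \<le> 3 * ((18 / 5 + 469 / 10000 * u) * ln 2)" by simp
  then show ?thesis using assms by (simp only: ln_realpow mult.assoc of_nat_numeral)
qed

text \<open>With \<open>u ^ 3 = n + 1\<close> and up to lower order terms, the left side of
  \<open>weighted_inert_primes_le\<close> is at least \<open>6.63 u ^ 3 ln 2\<close> and its right side is at most
  \<open>(6 u ^ 3 + 7.2 u\<^sup>2 + 0.0938 u ^ 3) ln 2\<close>, since \<open>6 card (small_split (n + 1)) \<le> u\<^sup>2\<close>.\<close>

lemma not_cube_large:
  assumes n: "n + 1 \<ge> 6297"
  shows "fact (n + 1) * quad_prod n \<noteq> c ^ 3"
proof
  assume cube: "fact (n + 1) * quad_prod n = c ^ 3"
  define N where "N = n + 1"
  define u where "u = root 3 (real N)"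
  define t where "t = real (card (small_split N))"
  have N: "real N \<ge> 6297" using n by (simp add: N_def)
  have u: "u ^ 3 = real N" by (simp add: u_def)
  have "u > 18"
  proof (rule power_less_imp_less_base)
    show "18 ^ 3 < u ^ 3" using N by (simp add: u)
  qed (simp add: u_def)
  have t: "6 * t \<le> u\<^sup>2"
  proof -
    have "(6 * t) ^ 3 = real ((6 * card (small_split N)) ^ 3)" by (simp add: t_def)
    also have "\<dots> \<le> real (N\<^sup>2)" using card_small_split[of N] by (simp only: of_nat_le_iff)
    also have "\<dots> = (u ^ 3)\<^sup>2" by (simp add: u)
    also have "\<dots> = (u\<^sup>2) ^ 3" by (simp flip: power_mult)
    finally show ?thesis by (subst (asm) power_mono_iff) (auto simp: t_def)
  qed
  define v where "v p = real (multiplicity p (fact N :: nat))" for p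
  \<comment> \<open>Each floor in Legendre's formula is replaced by its argument minus 1, so a term
    helps only when \<open>p ^ j < N\<close>; hence more terms for smaller primes.\<close>
  define l where "l J p = (\<Sum>j = 1..J. real N / real p ^ j) - real J" for J p :: nat
  have l2: "l 2 p = real N / real p + real N / real p ^ 2 - 2"
    and l3: "l 3 p = real N / real p + real N / real p ^ 2 + real N / real p ^ 3 - 3"
    and l4: "l 4 p = real N / real p + real N / real p ^ 2 + real N / real p ^ 3
      + real N / real p ^ 4 - 4"
    and l8: "l 8 p = real N / real p + real N / real p ^ 2 + real N / real p ^ 3
      + real N / real p ^ 4 + real N / real p ^ 5 + real N / real p ^ 6 + real N / real p ^ 7
      + real N / real p ^ 8 - 8" for p
    by (simp_all add: l_def eval_nat_numeral)
  have weight: "2 * l J p * (real a / real b * ln 2) \<le> 2 * v p * ln (real p)"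
    if "prime p" "2 ^ a \<le> p ^ b" "b > 0" "l J p \<ge> 0" for p a b J
    using that ln_ge_of_power_le[of p a b] multiplicity_fact_ge_real[of p N J]
    by (intro mult_mono) (auto simp: v_def l_def prime_gt_0_nat)
  define d where "d = 2 * v 3 - real (N div 3)"
  have main: "(\<Sum>p\<in>{2, 5, 11, 17, 23, 29, 41, 47}. 2 * v p * ln (real p)) + d * ln 3
      \<le> 3 * ln (real N) + 6 * real N * ln 2 + 4 * t * ln (real N)"
    using weighted_inert_primes_le[OF cube, of "{2, 5, 11, 17, 23, 29, 41, 47}"] n
    unfolding N_def[symmetric] v_def t_def d_def by (force simp: N_def)
  \<comment> \<open>Here and below the fractions lie just under log_2 p, such as 58/25 = 2.32 for 5
    and 79/50 = 1.58 for 3.\<close>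
  have w2: "2 * l 8 2 * (real 1 / real 1 * ln 2) \<le> 2 * v 2 * ln (real 2)"
    by (rule weight) (use N in \<open>simp_all add: l8\<close>)
  have w5: "2 * l 3 5 * (real 58 / real 25 * ln 2) \<le> 2 * v 5 * ln (real 5)"
    by (rule weight) (use N in \<open>simp_all add: l3\<close>)
  have w11: "2 * l 2 11 * (real 69 / real 20 * ln 2) \<le> 2 * v 11 * ln (real 11)"
    by (rule weight) (use N in \<open>simp_all add: l2\<close>)
  have w17: "2 * l 2 17 * (real 102 / real 25 * ln 2) \<le> 2 * v 17 * ln (real 17)"
    by (rule weight) (use N in \<open>simp_all add: l2\<close>)
  have w23: "2 * l 2 23 * (real 113 / real 25 * ln 2) \<le> 2 * v 23 * ln (real 23)"
    by (rule weight) (use N in \<open>simp_all add: l2\<close>)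
  have w29: "2 * l 2 29 * (real 97 / real 20 * ln 2) \<le> 2 * v 29 * ln (real 29)"
    by (rule weight) (use N in \<open>simp_all add: l2\<close>)
  have w41: "2 * l 2 41 * (real 107 / real 20 * ln 2) \<le> 2 * v 41 * ln (real 41)"
    by (rule weight) (use N in \<open>simp_all add: l2\<close>)
  have w47: "2 * l 2 47 * (real 111 / real 20 * ln 2) \<le> 2 * v 47 * ln (real 47)"
    by (rule weight) (use N in \<open>simp_all add: l2\<close>)
  have w3: "(2 * l 4 3 - real N / 3) * (real 79 / real 50 * ln 2) \<le> d * ln (real 3)"
  proof (rule mult_mono)
    have "real (N div 3) \<le> real N / 3" by linarith
    then show "2 * l 4 3 - real N / 3 \<le> d"
      using multiplicity_fact_ge_real[of 3 N 4] by (simp add: d_def v_def l_def)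
    then show "0 \<le> d" using N by (simp add: l4)
    show "real 79 / real 50 * ln 2 \<le> ln (real 3)" by (rule ln_ge_of_power_le) simp_all
  qed simp
  \<comment> \<open>6.63 is the coefficient of \<open>N\<close> on the right, rounded down; 154
    rounds up the weighted floor losses, which total 153.76.\<close>
  have "663 / 100 * u ^ 3 - 154 \<le> 2 * l 8 2 + 2 * l 3 5 * (58 / 25) + 2 * l 2 11 * (69 / 20)
      + 2 * l 2 17 * (102 / 25) + 2 * l 2 23 * (113 / 25) + 2 * l 2 29 * (97 / 20)
      + 2 * l 2 41 * (107 / 20) + 2 * l 2 47 * (111 / 20) + (2 * l 4 3 - real N / 3) * (79 / 50)"
    using N unfolding l2 l3 l4 l8 u by (simp add: field_simps)
  then have "(663 / 100 * u ^ 3 - 154) * ln 2 \<le> (2 * l 8 2 + 2 * l 3 5 * (58 / 25) + 2 * l 2 11 * (69 / 20)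
      + 2 * l 2 17 * (102 / 25) + 2 * l 2 23 * (113 / 25) + 2 * l 2 29 * (97 / 20)
      + 2 * l 2 41 * (107 / 20) + 2 * l 2 47 * (111 / 20) + (2 * l 4 3 - real N / 3) * (79 / 50)) * ln 2"
    by (intro mult_right_mono) auto
  also have "\<dots> \<le> (\<Sum>p\<in>{2, 5, 11, 17, 23, 29, 41, 47}. 2 * v p * ln (real p)) + d * ln 3"
  proof -
    have sum_eq: "(\<Sum>p\<in>{2, 5, 11, 17, 23, 29, 41, 47}. f p) = f 2 + f 5 + f 11 + f 17 + f 23 + f 29 + f 41 + f 47"
      for f :: "nat \<Rightarrow> real" by simp
    then show ?thesis
      using w2 w5 w11 w17 w23 w29 w41 w47 w3
      unfolding sum_eq distrib_right of_nat_numeral of_nat_1 mult.assoc div_by_1 mult_1 by linarith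
  qed
  also have "\<dots> \<le> 6 * u ^ 3 * ln 2 + (3 + 4 * t) * ln (u ^ 3)"
    using main unfolding u by (simp add: distrib_right)
  also have "(3 + 4 * t) * ln (u ^ 3) \<le> (3 + 2 / 3 * u\<^sup>2) * (3 * (18 / 5 + 469 / 10000 * u) * ln 2)"
    using ln_cube_le[of u] t \<open>u > 18\<close> by (intro mult_mono) auto
  finally have "(663 / 100 * u ^ 3 - 154) * ln 2
      \<le> (6 * u ^ 3 + (3 + 2 / 3 * u\<^sup>2) * (3 * (18 / 5 + 469 / 10000 * u))) * ln 2"
    by (simp only: distrib_right mult.assoc)
  then have bound: "663 / 100 * u ^ 3 - 154 \<le> 6 * u ^ 3 + (3 + 2 / 3 * u\<^sup>2) * (3 * (18 / 5 + 469 / 10000 * u))"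
    by (subst (asm) mult_le_cancel_right_pos) auto
  have expand: "(3 + 2 / 3 * u\<^sup>2) * (3 * (18 / 5 + 469 / 10000 * u))
      = 162 / 5 + 4221 / 10000 * u + 36 / 5 * u\<^sup>2 + 938 / 10000 * u ^ 3"
    by (simp add: field_simps power2_eq_square power3_eq_cube)
  \<comment> \<open>Divided by \<open>u\<^sup>2\<close>, the bound reads 0.5362 u \<le> 7.2 + 0.4221
    / u + 186.4 / u^2; for \<open>u > 18\<close> the left side exceeds 9.6 and the right side is
    below 7.8.\<close>
  have "18 * u\<^sup>2 \<le> u ^ 3" "18 * u \<le> u\<^sup>2" "18 * 18 \<le> u\<^sup>2"
    using \<open>u > 18\<close> mult_mono[of 18 u 18 u]
    by (simp_all add: power2_eq_square power3_eq_cube mult_right_mono)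
  then show False using bound[unfolded expand] by linarith
qed

section \<open>Small n and the conclusion\<close>

lemma prime_by_trial_division:
  fixes p :: nat
  assumes "1 < p" "p < m * m" "\<forall>d\<in>{2..<m}. \<not> d dvd p"
  shows "prime p"
proof (rule ccontr)
  assume "\<not> prime p"
  obtain q r where q: "prime q" "p = q * r"
    using prime_factor_nat[of p] assms(1) by (auto elim: dvdE)
  have "r \<ge> 2" using q \<open>\<not> prime p\<close> assms(1) by (cases r; cases "r = 1") auto
  have "q < m \<or> r < m"
    using assms(2) q(2) mult_le_mono[of m q m r] by linarith
  then show False
    using assms(3) q(2) \<open>r \<ge> 2\<close> prime_ge_2_nat[OF q(1)] dvd_triv_left[of q r] dvd_triv_right[of r q]
    by (metis atLeastLessThan_iff)
qed

theorem theorem1p1: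
  fixes n :: nat
  assumes "n > 0"
  shows "\<not> (\<exists>m :: int. (\<Prod>k = 1..n. (int k ^ 3 + 1)) = m ^ 3)"
proof
  assume "\<exists>m :: int. (\<Prod>k = 1..n. (int k ^ 3 + 1)) = m ^ 3"
  then obtain m :: int where m: "(\<Prod>k = 1..n. (int k ^ 3 + 1)) = m ^ 3" ..
  have "m ^ 3 > 0" unfolding m[symmetric] by (intro prod_pos) (simp add: add_nonneg_pos)
  then have "m > 0" by (simp add: zero_less_power_eq)
  then obtain c where c: "m = int c" by (metis zero_less_imp_eq_int)
  have "int (\<Prod>k = 1..n. k ^ 3 + 1) = int (c ^ 3)" using m unfolding c by (simp add: add.commute)
  then have "(\<Prod>k = 1..n. k ^ 3 + 1) = c ^ 3" by (simp only: of_nat_eq_iff)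
  then have cube: "fact (n + 1) * quad_prod n = c ^ 3" by (simp only: prod_cubes_eq)
  have gap: False if "prime p" "p mod 3 = 2" "p \<le> n + 1" "n + 1 < 3 * p" "n + 1 < p\<^sup>2" for p
    using not_cube_of_inert_prime[OF that] cube by blast
  have primes: "prime (239 :: nat)" "prime (701 :: nat)" "prime (2099 :: nat)"
    \<comment> \<open>16, 27 and 46 are the least \<open>m\<close> with \<open>m * m\<close> above
      the respective prime.\<close>
    using prime_by_trial_division[of 239 16] prime_by_trial_division[of 701 27]
      prime_by_trial_division[of 2099 46]
    by (simp_all add: atLeastLessThan_nat_numeral del: prime_nat_numeral_eq)
  \<comment> \<open>Each range for \<open>n + 1\<close> after \<open>n = 3\<close> and before the
    last ends just below \<open>3 * p\<close> for its prime \<open>p\<close>, and the next prime is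
    smaller than that end. \<open>n = 3\<close> stands apart because
    \<open>2\<^sup>2 > n + 1\<close> fails; there the product is 504, strictly between the cubes of
    7 and 8.\<close>
  consider "n + 1 < 4" | "n = 3" | "4 < n + 1" "n + 1 < 15" | "15 \<le> n + 1" "n + 1 < 33"
    | "33 \<le> n + 1" "n + 1 < 87" | "87 \<le> n + 1" "n + 1 < 249" | "249 \<le> n + 1" "n + 1 < 717"
    | "717 \<le> n + 1" "n + 1 < 2103" | "2103 \<le> n + 1" "n + 1 < 6297" | "6297 \<le> n + 1"
    by linarith
  then show False
  proof cases
    case 1 then show ?thesis using gap[of 2] assms by simp
  next
    case 2
    then have c504: "c ^ 3 = 504" using cube by (simp add: quad_prod_def eval_nat_numeral)
    have "c \<le> 7 \<or> 8 \<le> c" by linarith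
    then show ?thesis using c504 power_mono[of c 7 3] power_mono[of 8 c 3] by auto
  next
    case 3 then show ?thesis using gap[of 5] by simp
  next
    case 4 then show ?thesis using gap[of 11] by simp
  next
    case 5 then show ?thesis using gap[of 29] by simp
  next
    case 6 then show ?thesis using gap[of 83] by simp
  next
    case 7 then show ?thesis using gap[OF primes(1)] by simp
  next
    case 8 then show ?thesis using gap[OF primes(2)] by simp
  next
    case 9 then show ?thesis using gap[OF primes(3)] by simp
  next
    case 10
    from not_cube_large[OF this, of c] cube show ?thesis by contradiction
  qed
qed

end
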